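(* Suppose $f$ and $a_i$, $i=1,\dots,m$, are convex functions, and let $\{(x^k,y^k,s^k,\mu^k)\}\subset\mathbb{R}^n\times\mathbb{R}^m\times\mathbb{R}^m\times\mathbb{R}$ with $\mu^k>0$ for all $k$ and $\mu^k\to 0$ be such that: 1. $x^k\to x^*$ with $a(x^* )\le 0$, and $s^k\to -a(x^* )$; 2. $y^k\ge 0$ and $s^k\ge 0$; 3. for some $c\ge 0$ (independent of $k$), $(y^k)^{T}s^k\le \mu^k c$; 4. for some $0<\ell\le u$ (independent of $k$), $\mu^k\ell\le a_i(x^k)+s_i^k\le \mu^k u$ for all $i$ with $a_i(x^* )=0$; 5. for some $d\ge 0$ (independent of $k$), $\|\nabla_x\mathcal{L}(x^k,y^k)\|\le d\mu^k(\|y^k\|_1+1)$. Then $x^*$ is a solution (global minimizer) of the problem of minimizing $f(x)$ subject to $a(x)\le 0$. Moreover, if $x^*$ is a KKT point, then $$\limsup_{k\to\infty}\|y^k\|_1\le \frac{2u}{\ell}\|y^*\|_1+\frac{4c}{\ell}m+\frac{2(c+d)}{\ell},$$ where $y^*$ is any Lagrange multiplier associated with $x^*$.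
   Context: The functions $f:\mathbb{R}^n\to\mathbb{R}$ and $a=(a_1,\dots,a_m):\mathbb{R}^n\to\mathbb{R}^m$ are continuously differentiable. The problem under consideration is: minimize $f(x)$ subject to $a(x)+s=0$, $s\ge 0$ (equivalently, minimize $f(x)$ subject to $a(x)\le 0$). Vector inequalities are componentwise. The Lagrangian is $\mathcal{L}(x,y):=f(x)+y^{T}a(x)$. A Lagrange multiplier associated with a feasible point $x^*$ is a vector $y^*\in\mathbb{R}^m$ with $\nabla_x\mathcal{L}(x^*,y^* )=0$, $y^*\ge 0$ and $a(x^* )^{T}y^*=0$; $x^*$ is a KKT point if such a multiplier exists. $\|\cdot\|$ is the Euclidean norm, $\|\cdot\|_1$ the $\ell_1$-norm. Conditions on sequence elements stated without an explicit quantifier over $k$ are meant for all sufficiently large $k$. *)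

theory Defs
  imports "HOL-Analysis.Analysis"
begin

definition continuously_differentiable ::
    "('a::real_normed_vector \<Rightarrow> 'b::real_normed_vector) \<Rightarrow> bool" where
  "continuously_differentiable g \<longleftrightarrow>
     (\<exists>g' :: 'a \<Rightarrow> 'a \<Rightarrow>\<^sub>L 'b.
        (\<forall>x. (g has_derivative blinfun_apply (g' x)) (at x)) \<and> continuous_on UNIV g')"

text \<open>The gradient is meaningful only at points of differentiability
  (lemma \<open>gradient_eqI\<close>); elsewhere it is an unspecified vector.\<close>

definition gradient :: "('a::real_inner \<Rightarrow> real) \<Rightarrow> 'a \<Rightarrow> 'a" where
  "gradient g x = (THE D. GDERIV g x :> D)"

lemma gradient_eqI:
  assumes "GDERIV g x :> D"
  shows "gradient g x = D"
  unfolding gradient_def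
proof (rule the_equality)
  show "GDERIV g x :> D" by fact
next
  fix E assume "GDERIV g x :> E"
  with assms have "(\<lambda>h. h \<bullet> E) = (\<lambda>h. h \<bullet> D)"
    unfolding gderiv_def by (metis has_derivative_unique)
  then have "\<And>h. h \<bullet> E = h \<bullet> D" by (rule fun_cong)
  then show "E = D" by (metis inner_commute vector_eq_rdot)
qed

definition l1_norm :: "real^'m \<Rightarrow> real" where
  "l1_norm v = (\<Sum>i\<in>UNIV. \<bar>v $ i\<bar>)"

definition lagrangian ::
    "(real^'n \<Rightarrow> real) \<Rightarrow> (real^'n \<Rightarrow> real^'m) \<Rightarrow> real^'n \<Rightarrow> real^'m \<Rightarrow> real" where
  "lagrangian f a x y = f x + y \<bullet> a x"

text \<open>The order on \<open>real^'m\<close> is the componentwise one (\<open>less_eq_vec_def\<close>).\<close>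

definition lagrange_multiplier ::
    "(real^'n \<Rightarrow> real) \<Rightarrow> (real^'n \<Rightarrow> real^'m) \<Rightarrow> real^'n \<Rightarrow> real^'m \<Rightarrow> bool" where
  "lagrange_multiplier f a x y \<longleftrightarrow>
     a x \<le> 0 \<and> gradient (\<lambda>z. lagrangian f a z y) x = 0 \<and> 0 \<le> y \<and> a x \<bullet> y = 0"

definition KKT_point ::
    "(real^'n \<Rightarrow> real) \<Rightarrow> (real^'n \<Rightarrow> real^'m) \<Rightarrow> real^'n \<Rightarrow> bool" where
  "KKT_point f a x \<longleftrightarrow> (\<exists>y. lagrange_multiplier f a x y)"

end

theory Submission
  imports Defs
begin

text \<open>
  For feasible \<open>z\<close>, the tangent inequality for the convex function \<open>L(\<cdot>, y\<^sup>k)\<close> gives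
  \<open>f(z) \<ge> f(x\<^sup>k) + y\<^sup>k \<bullet> a(x\<^sup>k) - d \<mu>\<^sup>k (\<parallel>y\<^sup>k\<parallel>\<^sub>1 + 1) \<parallel>z - x\<^sup>k\<parallel>\<close>.
  Complementarity forces the inactive multipliers to be \<open>O(\<mu>\<^sup>k)\<close>, so
  \<open>y\<^sup>k \<bullet> a(x\<^sup>k) \<ge> \<mu>\<^sup>k (l \<parallel>y\<^sup>k\<parallel>\<^sub>1 - c - o(1))\<close>. If \<open>d \<parallel>z - x\<^sup>*\<parallel> < l\<close>, the possibly unbounded
  \<open>\<parallel>y\<^sup>k\<parallel>\<^sub>1\<close> has a nonnegative coefficient and can be dropped: \<open>x\<^sup>*\<close> is a local, hence global,
  minimizer. At \<open>z = x\<^sup>*\<close>, comparison with \<open>f(x\<^sup>*) \<le> f(x\<^sup>k) + y\<^sup>* \<bullet> a(x\<^sup>k) \<le> f(x\<^sup>k) + \<mu>\<^sup>k u \<parallel>y\<^sup>*\<parallel>\<^sub>1\<close>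
  gives even \<open>limsup \<parallel>y\<^sup>k\<parallel>\<^sub>1 \<le> (u \<parallel>y\<^sup>*\<parallel>\<^sub>1 + c) / l\<close>.
\<close>

text \<open>By the Riesz representation of the derivative, with vector \<open>adjoint g' 1\<close>:
  the definite description behind \<open>gradient\<close> denotes wherever the function is
  differentiable.\<close>

lemma gderiv_gradient:
  fixes g :: "'a::euclidean_space \<Rightarrow> real"
  assumes "g differentiable (at x)"
  shows "GDERIV g x :> gradient g x"
proof -
  obtain g' where g': "(g has_derivative g') (at x)"
    using assms by (auto simp: differentiable_def)
  then interpret linear g'
    by (rule has_derivative_linear)
  have "g' = (\<lambda>h. h \<bullet> adjoint g' 1)"
    using adjoint_works[OF linear_axioms, of _ 1] by auto
  then have "GDERIV g x :> adjoint g' 1"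
    using g' unfolding gderiv_def by metis
  then show ?thesis
    using gradient_eqI by metis
qed

text \<open>Restricting to the line through \<open>x\<close> and \<open>z\<close> reduces this to
  the tangent inequality for a convex function of one real variable, taken between parameters 0 and
  1.\<close>

lemma convex_above_gradient:
  fixes g :: "'a::euclidean_space \<Rightarrow> real"
  assumes cvx: "convex_on UNIV g" and diff: "g differentiable (at x)"
  shows "g x + (z - x) \<bullet> gradient g x \<le> g z"
proof -
  define p where "p t = g (x + t *\<^sub>R (z - x))" for t :: real
  have "convex_on UNIV p"
  proof (rule convex_onI)
    fix t a b :: real assume t: "0 < t" "t < 1"
    have eq: "x + ((1 - t) *\<^sub>R a + t *\<^sub>R b) *\<^sub>R (z - x) =
        (1 - t) *\<^sub>R (x + a *\<^sub>R (z - x)) + t *\<^sub>R (x + b *\<^sub>R (z - x))"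
      by (simp add: algebra_simps)
    show "p ((1 - t) *\<^sub>R a + t *\<^sub>R b) \<le> (1 - t) * p a + t * p b"
      unfolding p_def eq using convex_onD[OF cvx] t by simp
  qed simp
  moreover have "(p has_real_derivative (z - x) \<bullet> gradient g x) (at 0)"
  proof -
    have "(g has_derivative (\<lambda>h. h \<bullet> gradient g x)) (at (x + 0 *\<^sub>R (z - x)))"
      using gderiv_gradient[OF diff] by (simp add: gderiv_def)
    moreover have "((\<lambda>t. x + t *\<^sub>R (z - x)) has_derivative (\<lambda>t. t *\<^sub>R (z - x))) (at 0)"
      by (auto intro!: derivative_eq_intros)
    ultimately have "(p has_derivative (\<lambda>t. (t *\<^sub>R (z - x)) \<bullet> gradient g x)) (at 0)"
      unfolding p_def by (rule has_derivative_compose[rotated])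
    moreover have "(\<lambda>t. (t *\<^sub>R (z - x)) \<bullet> gradient g x) = (*) ((z - x) \<bullet> gradient g x)"
      by (simp add: fun_eq_iff mult.commute)
    ultimately show ?thesis
      by (simp only: has_field_derivative_def)
  qed
  ultimately have "p 1 - p 0 \<ge> ((z - x) \<bullet> gradient g x) * (1 - 0)"
    by (intro convex_on_imp_above_tangent[where A = UNIV]) auto
  then show ?thesis
    by (simp add: p_def)
qed

lemma continuously_differentiable_imp_differentiable:
  "continuously_differentiable g \<Longrightarrow> g differentiable (at x)"
  unfolding continuously_differentiable_def differentiable_def by blast

lemma convex_on_sum_fun:
  assumes "finite I" "convex S" "\<And>i. i \<in> I \<Longrightarrow> convex_on S (g i)"
  shows "convex_on S (\<lambda>z. \<Sum>i\<in>I. g i z)"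
  using assms by (induction I) (auto simp: convex_on_const)

text \<open>Nonnegative multipliers keep the Lagrangian convex in its first argument, so it lies
  above its tangents.\<close>

lemma lagrangian_above_gradient:
  fixes f :: "real^'n \<Rightarrow> real" and a :: "real^'n \<Rightarrow> real^'m"
  assumes f: "continuously_differentiable f" "convex_on UNIV f"
    and a: "continuously_differentiable a" "\<And>i. convex_on UNIV (\<lambda>z. a z $ i)"
    and y: "0 \<le> y"
  shows "lagrangian f a x y + (z - x) \<bullet> gradient (\<lambda>z. lagrangian f a z y) x \<le> lagrangian f a z y"
proof (rule convex_above_gradient)
  have "convex_on UNIV (\<lambda>z. \<Sum>i\<in>UNIV. y $ i * a z $ i)"
    using y a(2) by (intro convex_on_sum_fun convex_on_cmul) (auto simp: less_eq_vec_def)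
  then show "convex_on UNIV (\<lambda>z. lagrangian f a z y)"
    unfolding lagrangian_def inner_vec_def inner_real_def
    by (intro convex_on_add f)
next
  show "(\<lambda>z. lagrangian f a z y) differentiable (at x)"
    unfolding lagrangian_def
    by (intro differentiable_add differentiable_inner differentiable_const
        continuously_differentiable_imp_differentiable f a)
qed

lemma l1_norm_nonneg_eq: "0 \<le> v \<Longrightarrow> l1_norm v = (\<Sum>i\<in>UNIV. v $ i)"
  unfolding l1_norm_def by (simp add: less_eq_vec_def)

lemma inner_nonpos:
  fixes v w :: "real^'m"
  assumes "0 \<le> v" "w \<le> 0"
  shows "v \<bullet> w \<le> 0"
  using assms unfolding inner_vec_def inner_real_def
  by (intro sum_nonpos mult_nonneg_nonpos) (auto simp: less_eq_vec_def)

text \<open>Write \<open>y \<bullet> v\<close> as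
  \<open>y \<bullet> (v + s) - y \<bullet> s\<close>; the last product costs at most
  \<open>\<mu> * c\<close>. Outside \<open>I\<close> each summand of the first is at least
  \<open>\<mu> * l * y $ i\<close>. On \<open>I\<close>, complementarity gives
  \<open>y $ i \<le> \<mu> * (c / s $ i)\<close>, so these summands only contribute an error of
  order \<open>\<mu>\<close>.\<close>

lemma inner_perturbed_lower_bound:
  fixes v y s :: "real^'m"
  assumes y: "0 \<le> y" and s: "0 \<le> s" and ys: "y \<bullet> s \<le> \<mu> * c"
    and pos: "0 \<le> \<mu>" "0 \<le> l"
    and active: "\<And>i. i \<notin> I \<Longrightarrow> \<mu> * l \<le> v $ i + s $ i"
    and inactive: "\<And>i. i \<in> I \<Longrightarrow> 0 < s $ i"
  shows "\<mu> * (l * l1_norm y - c - (\<Sum>i\<in>I. c / s $ i * (\<mu> * l + \<bar>v $ i + s $ i\<bar>))) \<le> y \<bullet> v"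
proof -
  let ?e = "\<lambda>i. c / s $ i * (\<mu> * l + \<bar>v $ i + s $ i\<bar>)"
  have y0: "0 \<le> y $ i" and s0: "0 \<le> s $ i" for i
    using y s by (auto simp: less_eq_vec_def)
  have y_le: "y $ i \<le> \<mu> * (c / s $ i)" if "i \<in> I" for i
  proof -
    have "y $ i * s $ i \<le> (\<Sum>j\<in>UNIV. y $ j * s $ j)"
      using y0 s0 by (intro member_le_sum) auto
    then have "y $ i * s $ i \<le> \<mu> * c"
      using ys by (simp add: inner_vec_def)
    then show ?thesis
      using inactive[OF that] by (simp add: field_simps)
  qed
  \<comment> \<open>The full \<open>l1_norm y\<close> is to appear, so
    \<open>\<mu> * l * y $ i\<close> is charged for \<open>i \<in> I\<close> too; the summand
    \<open>\<mu> * l\<close> inside \<open>?e i\<close> pays for it.\<close>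
  have "\<mu> * l * y $ i - (if i \<in> I then \<mu> * ?e i else 0) \<le> y $ i * (v $ i + s $ i)" for i
  proof (cases "i \<in> I")
    case True
    have "y $ i * (\<mu> * l + \<bar>v $ i + s $ i\<bar>) \<le> \<mu> * (c / s $ i) * (\<mu> * l + \<bar>v $ i + s $ i\<bar>)"
      using y_le[OF True] pos by (intro mult_right_mono) auto
    moreover have "- (y $ i * \<bar>v $ i + s $ i\<bar>) \<le> y $ i * (v $ i + s $ i)"
      using mult_left_mono[OF abs_ge_minus_self[of "v $ i + s $ i"] y0[of i]]
      by (simp add: algebra_simps)
    ultimately show ?thesis
      using True by (simp add: algebra_simps)
  next
    case False
    then show ?thesis
      using mult_left_mono[OF active[OF False] y0[of i]] by (simp add: mult_ac)
  qed
  then have "(\<Sum>i\<in>UNIV. \<mu> * l * y $ i - (if i \<in> I then \<mu> * ?e i else 0))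
      \<le> (\<Sum>i\<in>UNIV. y $ i * (v $ i + s $ i))"
    by (rule sum_mono)
  also have "\<dots> = y \<bullet> v + y \<bullet> s"
    by (simp add: inner_vec_def distrib_left sum.distrib)
  also have "(\<Sum>i\<in>UNIV. \<mu> * l * y $ i - (if i \<in> I then \<mu> * ?e i else 0))
      = \<mu> * l * l1_norm y - \<mu> * (\<Sum>i\<in>I. ?e i)"
    by (simp add: sum_subtractf l1_norm_nonneg_eq[OF y] sum_distrib_left
        flip: sum.inter_restrict[where A = UNIV, simplified])
  finally show ?thesis
    using ys by (simp add: algebra_simps)
qed

theorem theorem1:
  fixes f :: "real^'n \<Rightarrow> real"
    and a :: "real^'n \<Rightarrow> real^'m"
    and x :: "nat \<Rightarrow> real^'n"
    and y s :: "nat \<Rightarrow> real^'m"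
    and \<mu> :: "nat \<Rightarrow> real"
    and xstar :: "real^'n"
    and c d l u :: real
  assumes f_C1: "continuously_differentiable f"
    and a_C1: "continuously_differentiable a"
    and f_convex: "convex_on UNIV f"
    and a_convex: "\<And>i. convex_on UNIV (\<lambda>z. a z $ i)"
    and mu_pos: "\<And>k. \<mu> k > 0"
    and mu_lim: "\<mu> \<longlonglongrightarrow> 0"
    and x_lim: "x \<longlonglongrightarrow> xstar"
    and xstar_feasible: "a xstar \<le> 0"
    and s_lim: "s \<longlonglongrightarrow> - a xstar"
    and nonneg: "\<forall>\<^sub>F k in sequentially. 0 \<le> y k \<and> 0 \<le> s k"
    and c_nonneg: "0 \<le> c"
    and compl: "\<forall>\<^sub>F k in sequentially. y k \<bullet> s k \<le> \<mu> k * c"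
    and l_pos: "0 < l"
    and l_le_u: "l \<le> u"
    and primal: "\<forall>\<^sub>F k in sequentially. \<forall>i. a xstar $ i = 0 \<longrightarrow>
          \<mu> k * l \<le> a (x k) $ i + s k $ i \<and> a (x k) $ i + s k $ i \<le> \<mu> k * u"
    and d_nonneg: "0 \<le> d"
    and dual: "\<forall>\<^sub>F k in sequentially.
          norm (gradient (\<lambda>z. lagrangian f a z (y k)) (x k)) \<le> d * \<mu> k * (l1_norm (y k) + 1)"
  shows "is_arg_min f (\<lambda>z. a z \<le> 0) xstar \<and>
    (KKT_point f a xstar \<longrightarrow>
      (\<forall>ystar. lagrange_multiplier f a xstar ystar \<longrightarrow>
        limsup (\<lambda>k. ereal (l1_norm (y k)))
          \<le> ereal (2 * u / l * l1_norm ystar + 4 * c / l * real CARD('m) + 2 * (c + d) / l)))"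
proof -

  \<comment> \<open>Inactive constraints and limits of the error terms\<close>
  define I where "I = {i. a xstar $ i \<noteq> 0}"
  define e where "e k = (\<Sum>i\<in>I. c / s k $ i * (\<mu> k * l + \<bar>a (x k) $ i + s k $ i\<bar>))" for k
  define D where "D z k = d * norm (z - x k)" for z k
  let ?Y = "\<lambda>k. l1_norm (y k)"
  have f_lim: "(\<lambda>k. f (x k)) \<longlonglongrightarrow> f xstar"
    and a_lim: "(\<lambda>k. a (x k)) \<longlonglongrightarrow> a xstar"
    using f_C1 a_C1 x_lim
    by (auto intro!: isCont_tendsto_compose[OF _ x_lim] differentiable_imp_continuous_within
        continuously_differentiable_imp_differentiable)
  have s_pos: "\<forall>\<^sub>F k in sequentially. \<forall>i\<in>I. 0 < s k $ i"
  proof (rule eventually_ball_finite)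
    show "\<forall>i\<in>I. \<forall>\<^sub>F k in sequentially. 0 < s k $ i"
    proof
      fix i assume "i \<in> I"
      then have "0 < (- a xstar) $ i"
        using xstar_feasible by (auto simp: I_def less_eq_vec_def order.strict_iff_order)
      then show "\<forall>\<^sub>F k in sequentially. 0 < s k $ i"
        using order_tendstoD(1)[OF tendsto_vec_nth[OF s_lim]] by blast
    qed
  qed simp
  \<comment> \<open>For \<open>i \<in> I\<close> the denominators tend to
    \<open>- a xstar $ i\<close>, which is nonzero, while \<open>a (x k) $ i + s k $ i\<close> and
    \<open>\<mu> k\<close> tend to 0.\<close>
  have e_lim: "e \<longlonglongrightarrow> 0"
  proof -
    have "e \<longlonglongrightarrow> (\<Sum>i\<in>I. c / (- a xstar) $ i * (0 * l + \<bar>a xstar $ i + (- a xstar) $ i\<bar>))"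
      unfolding e_def
      by (intro tendsto_sum tendsto_mult tendsto_divide tendsto_add tendsto_rabs tendsto_const
          tendsto_vec_nth s_lim mu_lim a_lim) (auto simp: I_def)
    then show ?thesis
      by simp
  qed
  have D_lim: "D z \<longlonglongrightarrow> d * norm (z - xstar)" for z
    unfolding D_def by (intro tendsto_intros x_lim)
  \<comment> \<open>The gradient error \<open>d * \<mu> k * (?Y k + 1) * norm (z - x k)\<close>
    equals \<open>\<mu> k * (D z k * ?Y k + D z k)\<close>: one part lowers the coefficient of
    \<open>?Y k\<close> from \<open>l\<close> to \<open>l - D z k\<close>, the other joins the
    bounded errors.\<close>
  have key: "\<forall>\<^sub>F k in sequentially.
      f (x k) + \<mu> k * ((l - D z k) * ?Y k - c - e k - D z k) \<le> f z"
    if z: "a z \<le> 0" for z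
    using nonneg compl primal dual s_pos
  proof eventually_elim
    case (elim k)
    let ?g = "gradient (\<lambda>z. lagrangian f a z (y k)) (x k)"
    have "\<mu> k * (l * ?Y k - c - e k) \<le> y k \<bullet> a (x k)"
      unfolding e_def using elim mu_pos[of k] l_pos
      by (intro inner_perturbed_lower_bound) (auto simp: I_def)
    moreover have "\<bar>(z - x k) \<bullet> ?g\<bar> \<le> norm (z - x k) * norm ?g"
      by (rule Cauchy_Schwarz_ineq2)
    moreover have "norm (z - x k) * norm ?g \<le> norm (z - x k) * (d * \<mu> k * (?Y k + 1))"
      using elim by (intro mult_left_mono) auto
    moreover have "lagrangian f a (x k) (y k) + (z - x k) \<bullet> ?g \<le> lagrangian f a z (y k)"
      using elim by (intro lagrangian_above_gradient f_C1 f_convex a_C1 a_convex) auto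
    moreover have "y k \<bullet> a z \<le> 0"
      using elim z by (intro inner_nonpos) auto
    ultimately show ?case
      by (simp add: lagrangian_def D_def algebra_simps)
  qed

  \<comment> \<open>Minimality of the limit point, first locally and then globally\<close>
  have local_min: "f xstar \<le> f w" if w: "a w \<le> 0" "d * norm (w - xstar) < l" for w
  proof (rule tendsto_upperbound)
    have "(\<lambda>k. f (x k) - \<mu> k * (c + e k + D w k)) \<longlonglongrightarrow>
        f xstar - 0 * (c + 0 + d * norm (w - xstar))"
      by (intro tendsto_intros f_lim mu_lim e_lim D_lim)
    then show "(\<lambda>k. f (x k) - \<mu> k * (c + e k + D w k)) \<longlonglongrightarrow> f xstar"
      by simp
    have "\<forall>\<^sub>F k in sequentially. D w k < l"
      using order_tendstoD(2)[OF D_lim w(2)] .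
    then show "\<forall>\<^sub>F k in sequentially. f (x k) - \<mu> k * (c + e k + D w k) \<le> f w"
      using key[OF w(1)]
    proof eventually_elim
      case (elim k)
      have "0 \<le> \<mu> k * ((l - D w k) * ?Y k)"
        using elim mu_pos[of k] by (auto simp: l1_norm_def intro!: mult_nonneg_nonneg sum_nonneg)
      then show ?case
        using elim by (simp add: algebra_simps)
    qed
  qed simp
  have global_min: "f xstar \<le> f z" if z: "a z \<le> 0" for z
  proof -
    \<comment> \<open>This \<open>t\<close> solves
      \<open>t * (l + d * norm (z - xstar)) = l\<close>, which pulls \<open>w\<close> strictly
      inside the range of \<open>local_min\<close>; for \<open>d = 0\<close> it is 1 and
      \<open>w\<close> is \<open>z\<close>.\<close>
    define t where "t = l / (l + d * norm (z - xstar))"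
    define w where "w = (1 - t) *\<^sub>R xstar + t *\<^sub>R z"
    have den: "0 < l + d * norm (z - xstar)"
      using l_pos d_nonneg by (simp add: add_pos_nonneg)
    have t: "0 < t" "t \<le> 1"
      using l_pos d_nonneg den by (auto simp: t_def)
    have "a w $ i \<le> 0" for i
    proof -
      have "a w $ i \<le> (1 - t) * a xstar $ i + t * a z $ i"
        unfolding w_def using t by (intro convex_onD[OF a_convex]) auto
      also have "\<dots> \<le> 0"
        using t z xstar_feasible
        by (intro add_nonpos_nonpos mult_nonneg_nonpos) (auto simp: less_eq_vec_def)
      finally show ?thesis .
    qed
    then have "a w \<le> 0"
      by (simp add: less_eq_vec_def)
    moreover have "d * norm (w - xstar) < l"
    proof -
      have "w - xstar = t *\<^sub>R (z - xstar)"
        by (simp add: w_def algebra_simps)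
      then have "d * norm (w - xstar) = t * (d * norm (z - xstar))"
        using t by simp
      also have "\<dots> < t * (l + d * norm (z - xstar))"
        using t l_pos by simp
      also have "\<dots> = l"
        using den by (simp add: t_def)
      finally show ?thesis .
    qed
    ultimately have "f xstar \<le> f w"
      by (rule local_min)
    also have "f w \<le> (1 - t) * f xstar + t * f z"
      unfolding w_def using t by (intro convex_onD[OF f_convex]) auto
    finally have "t * f xstar \<le> t * f z"
      by (simp add: algebra_simps)
    then show ?thesis
      using t by simp
  qed

  \<comment> \<open>The bound on the multipliers\<close>
  have limsup_le: "limsup (\<lambda>k. ereal (?Y k)) \<le>
      ereal (2 * u / l * l1_norm ystar + 4 * c / l * real CARD('m) + 2 * (c + d) / l)"
    if mult: "lagrange_multiplier f a xstar ystar" for ystar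
  proof -
    define B where "B = u * l1_norm ystar + c"
    have ystar: "0 \<le> ystar" "a xstar \<bullet> ystar = 0"
      "gradient (\<lambda>z. lagrangian f a z ystar) xstar = 0"
      using mult by (auto simp: lagrange_multiplier_def)
    have ystar0: "0 \<le> ystar $ i" for i
      using ystar(1) by (simp add: less_eq_vec_def)
    \<comment> \<open>Complementarity holds termwise, because a sum of nonnegative terms vanishes
      only if every term does.\<close>
    have ystar_inactive: "ystar $ i = 0" if "i \<in> I" for i
    proof -
      have "(\<Sum>i\<in>UNIV. - (a xstar $ i * ystar $ i)) = 0"
        using ystar(2) by (simp add: inner_vec_def sum_negf)
      moreover have "0 \<le> - (a xstar $ i * ystar $ i)" for i
        using xstar_feasible ystar0[of i] by (simp add: less_eq_vec_def mult_nonpos_nonneg)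
      ultimately have "- (a xstar $ i * ystar $ i) = 0"
        by (simp add: sum_nonneg_eq_0_iff)
      then show ?thesis
        using that by (simp add: I_def)
    qed
    \<comment> \<open>The tangent at \<open>xstar\<close> is horizontal, so \<open>xstar\<close>
      minimizes the convex Lagrangian for \<open>ystar\<close>; its value there is
      \<open>f xstar\<close> by complementarity.\<close>
    have saddle: "f xstar \<le> f z + ystar \<bullet> a z" for z
      using lagrangian_above_gradient[OF f_C1 f_convex a_C1 a_convex ystar(1), of xstar z] ystar
      by (simp add: lagrangian_def inner_commute)
    have "\<forall>\<^sub>F k in sequentially. D xstar k < l"
      using order_tendstoD(2)[OF D_lim] l_pos by simp
    then have bound: "\<forall>\<^sub>F k in sequentially. ?Y k \<le> (B + e k + D xstar k) / (l - D xstar k)"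
      using nonneg primal key[OF xstar_feasible]
    proof eventually_elim
      case (elim k)
      \<comment> \<open>For active \<open>i\<close>, \<open>s k $ i \<ge> 0\<close> turns the upper
        bound on \<open>a (x k) $ i + s k $ i\<close> into one on \<open>a (x k) $ i\<close>
        alone.\<close>
      have "ystar $ i * a (x k) $ i \<le> ystar $ i * (\<mu> k * u)" for i
      proof (cases "i \<in> I")
        case False
        moreover have "0 \<le> s k $ i"
          using elim by (simp add: less_eq_vec_def)
        ultimately have "a (x k) $ i \<le> \<mu> k * u"
          using elim by (force simp: I_def)
        then show ?thesis
          using ystar0 by (rule mult_left_mono)
      qed (simp add: ystar_inactive)
      then have "ystar \<bullet> a (x k) \<le> (\<Sum>i\<in>UNIV. ystar $ i * (\<mu> k * u))"
        unfolding inner_vec_def inner_real_def by (rule sum_mono)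
      also have "\<dots> = \<mu> k * (u * l1_norm ystar)"
        by (simp add: l1_norm_nonneg_eq[OF ystar(1)] sum_distrib_left mult_ac)
      finally have "\<mu> k * ((l - D xstar k) * ?Y k - c - e k - D xstar k) \<le> \<mu> k * (u * l1_norm ystar)"
        using saddle[of "x k"] elim by linarith
      then have "(l - D xstar k) * ?Y k \<le> B + e k + D xstar k"
        using mu_pos[of k] by (simp add: B_def)
      then show ?case
        using elim by (simp add: field_simps)
    qed
    have "(\<lambda>k. (B + e k + D xstar k) / (l - D xstar k)) \<longlonglongrightarrow>
        (B + 0 + d * norm (xstar - xstar)) / (l - d * norm (xstar - xstar))"
      using l_pos by (intro tendsto_intros e_lim D_lim) auto
    then have "(\<lambda>k. ereal ((B + e k + D xstar k) / (l - D xstar k))) \<longlonglongrightarrow> ereal (B / l)"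
      by simp
    then have "limsup (\<lambda>k. ereal ((B + e k + D xstar k) / (l - D xstar k))) = ereal (B / l)"
      by (intro lim_imp_Limsup) auto
    moreover have "limsup (\<lambda>k. ereal (?Y k)) \<le>
        limsup (\<lambda>k. ereal ((B + e k + D xstar k) / (l - D xstar k)))"
      using bound by (intro Limsup_mono) simp
    \<comment> \<open>\<open>2 * (c + d)\<close> absorbs the \<open>c\<close> in \<open>B\<close>;
      the remaining surplus is nonnegative.\<close>
    moreover have "B / l \<le> 2 * u / l * l1_norm ystar + 4 * c / l * real CARD('m) + 2 * (c + d) / l"
    proof -
      have "0 \<le> u * l1_norm ystar"
        using l_pos l_le_u by (auto simp: l1_norm_def intro!: mult_nonneg_nonneg sum_nonneg)
      moreover have "0 \<le> c * real CARD('m)"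
        using c_nonneg by simp
      ultimately have "B \<le> 2 * (u * l1_norm ystar) + 4 * (c * real CARD('m)) + 2 * (c + d)"
        unfolding B_def distrib_left using c_nonneg d_nonneg by linarith
      then have "B / l \<le> (2 * (u * l1_norm ystar) + 4 * (c * real CARD('m)) + 2 * (c + d)) / l"
        using l_pos by (intro divide_right_mono) auto
      then show ?thesis
        by (simp add: add_divide_distrib mult.assoc)
    qed
    ultimately show ?thesis
      by (metis ereal_less_eq(3) order_trans)
  qed
  show ?thesis
    using xstar_feasible global_min limsup_le by (auto simp: is_arg_min_linorder)
qed

end
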